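(* Let $n\in\mathbb N$ and let $\varepsilon\in M_n(\{0,1\})$ be symmetric with zero diagonal. If $\varepsilon\neq\varepsilon_{\mathrm{comm}}$ and $\varepsilon\neq\varepsilon_{\mathrm{free}}$, then $$O_n\not\subset O_n^\varepsilon\subsetneq O_n^+ .$$ More generally, in that case $$S_n\not\subset O_n^\varepsilon\subsetneq O_n^+ .$$
   Context: The matrix $\varepsilon_{\mathrm{comm}}$ has $\varepsilon_{ij}=1$ for all $i\ne j$ and zero diagonal; $\varepsilon_{\mathrm{free}}$ is the zero matrix. $C(O_n^+)$ is the universal unital $C^*$-algebra generated by $u_{ij}$, $1\le i,j\le n$, with $u_{ij}=u_{ij}^*$ and $\sum_k u_{ik}u_{jk}=\sum_k u_{ki}u_{kj}=\delta_{ij}$. $C(O_n^\varepsilon)$ is its quotient by the relations $R^\varepsilon$: $$u_{ik}u_{jl}=\begin{cases}u_{jl}u_{ik}&\text{if }\varepsilon_{ij}=1,\ \varepsilon_{kl}=1\\ u_{jk}u_{il}&\text{if }\varepsilon_{ij}=1,\ \varepsilon_{kl}=0\\ u_{il}u_{jk}&\text{if }\varepsilon_{ij}=0,\ \varepsilon_{kl}=1.\end{cases}$$ $C(O_n)$ and $C(S_n)$ are the algebras of continuous functions on the orthogonal group $O_n\subset M_n(\mathbb R)$ and on the symmetric group $S_n$ (as permutation matrices $a^\sigma_{pq}=\delta_{p\sigma(q)}$), generated by the coordinate functions $u_{ij}$. For compact matrix quantum groups, $G\subset H$ means that there is a surjective $*$-homomorphism $C(H)\to C(G)$ sending generators $u_{ij}$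 to generators $u_{ij}$; $G\subsetneq H$ means that $G\subset H$ and this map is not injective. *)

theory Defs
  imports
    "HOL-Analysis.Analysis"
    "HOL-Algebra.QuotRing"
    "HOL-Algebra.Module"
    "HOL-Library.Poly_Mapping"
begin

section \<open>The free unital *-algebra\<close>

text \<open>A generator \<open>e\<close> contributes two letters, \<open>Gen e\<close> and its formal adjoint \<open>Adj e\<close>.  Words
  form the free monoid on the letters, written additively so that the convolution product of
  \<^theory>\<open>HOL-Library.Poly_Mapping\<close> makes the finitely supported functions from words to \<open>complex\<close>
  the ring of noncommutative polynomials.  The empty word is \<open>0\<close>.\<close>

datatype 'e letter = Gen 'e | Adj 'e

datatype 'e star_word = Word (letters: "'e letter list")

instantiation star_word :: (type) monoid_add
begin

definition zero_star_word :: "'a star_word"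
  where "0 = Word []"

definition plus_star_word :: "'a star_word \<Rightarrow> 'a star_word \<Rightarrow> 'a star_word"
  where "v + w = Word (letters v @ letters w)"

instance
  by standard (simp_all add: zero_star_word_def plus_star_word_def)

end

type_synonym 'e free_alg = "'e star_word \<Rightarrow>\<^sub>0 complex"

primrec letter_adj :: "'e letter \<Rightarrow> 'e letter" where
  "letter_adj (Gen e) = Adj e"
| "letter_adj (Adj e) = Gen e"

definition word_adj :: "'e star_word \<Rightarrow> 'e star_word"
  where "word_adj w = Word (rev (map letter_adj (letters w)))"

definition free_gen :: "'e \<Rightarrow> 'e free_alg"
  where "free_gen e = Poly_Mapping.single (Word [Gen e]) 1"

definition free_scale :: "complex \<Rightarrow> 'e free_alg \<Rightarrow> 'e free_alg"
  where "free_scale c x = Poly_Mapping.map (\<lambda>z. c * z) x"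

definition free_adj :: "'e free_alg \<Rightarrow> 'e free_alg"
  where "free_adj x =
    (\<Sum>w\<in>Poly_Mapping.keys x. Poly_Mapping.single (word_adj w) (cnj (Poly_Mapping.lookup x w)))"


section \<open>Unital C*-algebras as records, *-homomorphisms and quotients\<close>

record 'a cstar = "(complex, 'a) module" +
  adj :: "'a \<Rightarrow> 'a"
  cnorm :: "'a \<Rightarrow> real"

definition star_hom :: "'a cstar \<Rightarrow> 'b cstar \<Rightarrow> ('a \<Rightarrow> 'b) set"
  where "star_hom A B = {\<phi> \<in> ring_hom A B.
    (\<forall>c. \<forall>x\<in>carrier A. \<phi> (c \<odot>\<^bsub>A\<^esub> x) = c \<odot>\<^bsub>B\<^esub> \<phi> x) \<and>
    (\<forall>x\<in>carrier A. \<phi> (adj A x) = adj B (\<phi> x))}"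

text \<open>Note that \<^const>\<open>ring_hom\<close> includes preservation of the unit.\<close>

definition cstar_quot :: "'a cstar \<Rightarrow> 'a set \<Rightarrow> 'a set cstar"
  where "cstar_quot A I =
    \<lparr>carrier = carrier (A Quot I), mult = mult (A Quot I), one = one (A Quot I),
     zero = zero (A Quot I), add = add (A Quot I),
     smult = (\<lambda>c X. \<Union>x\<in>X. I +>\<^bsub>A\<^esub> (c \<odot>\<^bsub>A\<^esub> x)),
     adj = (\<lambda>X. \<Union>x\<in>X. I +>\<^bsub>A\<^esub> adj A x),
     cnorm = (\<lambda>X. INF x\<in>X. cnorm A x)\<rparr>"

text \<open>The closed two-sided *-ideal generated by a set; \<^const>\<open>ideal\<close> is two-sided over a
  noncommutative ring.\<close>

definition closed_star_ideal :: "'a set \<Rightarrow> 'a cstar \<Rightarrow> bool"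
  where "closed_star_ideal I A \<longleftrightarrow>
    ideal I A \<and> (\<forall>x\<in>I. adj A x \<in> I) \<and>
    (\<forall>x\<in>carrier A. (\<forall>e>0. \<exists>y\<in>I. cnorm A (x \<ominus>\<^bsub>A\<^esub> y) < e) \<longrightarrow> x \<in> I)"

definition closed_ideal_gen :: "'a cstar \<Rightarrow> 'a set \<Rightarrow> 'a set"
  where "closed_ideal_gen A S = \<Inter> {I. closed_star_ideal I A \<and> S \<subseteq> I}"


section \<open>Universal unital C*-algebras\<close>

text \<open>Relations are given as a set \<open>R\<close> of *-polynomials that are required to vanish.  The
  universal C*-algebra is the separated completion of the free *-algebra with respect to the
  largest C*-seminorm that vanishes on \<open>R\<close> (equivalently, on the *-ideal generated by \<open>R\<close>).  It
  exists if these C*-seminorms are pointwise bounded (as for the orthogonality relations below,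
  which force every \<open>q u\<^sub>i\<^sub>j \<le> 1\<close>); otherwise the supremum below is meaningless.\<close>

definition cstar_seminorm :: "('e free_alg \<Rightarrow> real) \<Rightarrow> bool"
  where "cstar_seminorm q \<longleftrightarrow>
    (\<forall>x. 0 \<le> q x) \<and>
    (\<forall>x y. q (x + y) \<le> q x + q y) \<and>
    (\<forall>c x. q (free_scale c x) = cmod c * q x) \<and>
    (\<forall>x y. q (x * y) \<le> q x * q y) \<and>
    (\<forall>x. q (free_adj x * x) = (q x)\<^sup>2)"

definition universal_seminorm :: "'e free_alg set \<Rightarrow> 'e free_alg \<Rightarrow> real"
  where "universal_seminorm R x = (SUP q\<in>{q. cstar_seminorm q \<and> (\<forall>r\<in>R. q r = 0)}. q x)"

text \<open>Separated completion: Cauchy sequences modulo null sequences.\<close>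

definition cauchy_seqs :: "('e free_alg \<Rightarrow> real) \<Rightarrow> (nat \<Rightarrow> 'e free_alg) set"
  where "cauchy_seqs p = {X. \<forall>e>0. \<exists>N. \<forall>m\<ge>N. \<forall>n\<ge>N. p (X m - X n) < e}"

definition null_seqs :: "('e free_alg \<Rightarrow> real) \<Rightarrow> (nat \<Rightarrow> 'e free_alg) set"
  where "null_seqs p = {X. (\<lambda>n. p (X n)) \<longlonglongrightarrow> 0}"

definition cauchy_alg :: "('e free_alg \<Rightarrow> real) \<Rightarrow> (nat \<Rightarrow> 'e free_alg) cstar"
  where "cauchy_alg p =
    \<lparr>carrier = cauchy_seqs p, mult = (\<lambda>X Y n. X n * Y n), one = (\<lambda>n. 1),
     zero = (\<lambda>n. 0), add = (\<lambda>X Y n. X n + Y n),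
     smult = (\<lambda>c X n. free_scale c (X n)),
     adj = (\<lambda>X n. free_adj (X n)),
     cnorm = (\<lambda>X. lim (\<lambda>n. p (X n)))\<rparr>"

definition universal_cstar :: "'e free_alg set \<Rightarrow> (nat \<Rightarrow> 'e free_alg) set cstar"
  where "universal_cstar R =
    cstar_quot (cauchy_alg (universal_seminorm R)) (null_seqs (universal_seminorm R))"

definition universal_gen :: "'e free_alg set \<Rightarrow> 'e \<Rightarrow> (nat \<Rightarrow> 'e free_alg) set"
  where "universal_gen R e =
    null_seqs (universal_seminorm R) +>\<^bsub>cauchy_alg (universal_seminorm R)\<^esub> (\<lambda>n. free_gen e)"


section \<open>Compact matrix quantum groups and inclusions\<close>

text \<open>Only the data that enter the notion of inclusion are recorded: the algebra \<open>C(G)\<close> and its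
  generators \<open>u\<^sub>i\<^sub>j\<close>.  The index set \<open>{1,\<dots>,n}\<close> is a finite type \<open>'n\<close>.\<close>

record ('n, 'a) cmqg =
  alg :: "'a cstar"
  gen :: "'n \<Rightarrow> 'n \<Rightarrow> 'a"

definition quantum_inclusion :: "('n, 'a) cmqg \<Rightarrow> ('n, 'b) cmqg \<Rightarrow> ('b \<Rightarrow> 'a) \<Rightarrow> bool"
  where "quantum_inclusion G H \<phi> \<longleftrightarrow>
    \<phi> \<in> star_hom (alg H) (alg G) \<and> \<phi> ` carrier (alg H) = carrier (alg G) \<and>
    (\<forall>i j. \<phi> (gen H i j) = gen G i j)"

definition quantum_subgroup :: "('n, 'a) cmqg \<Rightarrow> ('n, 'b) cmqg \<Rightarrow> bool"
    (infix \<open>\<subseteq>\<^sub>Q\<close> 50)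
  where "G \<subseteq>\<^sub>Q H \<longleftrightarrow> (\<exists>\<phi>. quantum_inclusion G H \<phi>)"

definition proper_quantum_subgroup :: "('n, 'a) cmqg \<Rightarrow> ('n, 'b) cmqg \<Rightarrow> bool"
    (infix \<open>\<subset>\<^sub>Q\<close> 50)
  where "G \<subset>\<^sub>Q H \<longleftrightarrow> (\<exists>\<phi>. quantum_inclusion G H \<phi> \<and> \<not> inj_on \<phi> (carrier (alg H)))"


section \<open>Classical matrix groups\<close>

text \<open>Continuous functions on \<open>X\<close> are extended by \<^const>\<open>undefined\<close> outside \<open>X\<close>, so that equality
  in the algebra is equality on \<open>X\<close>.\<close>

definition cfun_alg :: "'a::topological_space set \<Rightarrow> ('a \<Rightarrow> complex) cstar"
  where "cfun_alg X =
    \<lparr>carrier = {f \<in> extensional X. continuous_on X f},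
     mult = (\<lambda>f g. \<lambda>x\<in>X. f x * g x), one = (\<lambda>x\<in>X. 1),
     zero = (\<lambda>x\<in>X. 0), add = (\<lambda>f g. \<lambda>x\<in>X. f x + g x),
     smult = (\<lambda>c f. \<lambda>x\<in>X. c * f x),
     adj = (\<lambda>f. \<lambda>x\<in>X. cnj (f x)),
     cnorm = (\<lambda>f. SUP x\<in>X. cmod (f x))\<rparr>"

definition classical_cmqg :: "(real^'n^'n) set \<Rightarrow> ('n, real^'n^'n \<Rightarrow> complex) cmqg"
  where "classical_cmqg X =
    \<lparr>alg = cfun_alg X, gen = (\<lambda>i j. \<lambda>a\<in>X. complex_of_real (a $ i $ j))\<rparr>"

definition O_classical :: "('n::finite, real^'n^'n \<Rightarrow> complex) cmqg"
  where "O_classical = classical_cmqg {a. orthogonal_matrix a}"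

definition permutation_matrix :: "('n \<Rightarrow> 'n) \<Rightarrow> real^'n^'n"
  where "permutation_matrix \<sigma> = (\<chi> p q. if p = \<sigma> q then 1 else 0)"

definition S_classical :: "('n::finite, real^'n^'n \<Rightarrow> complex) cmqg"
  where "S_classical = classical_cmqg {permutation_matrix \<sigma> | \<sigma>. bij \<sigma>}"


section \<open>The quantum groups \<open>O\<^sub>n\<^sup>+\<close> and \<open>O\<^sub>n\<^sup>\<epsilon>\<close>\<close>

definition orthogonal_relations :: "('n::finite \<times> 'n) free_alg set"
  where "orthogonal_relations =
    {free_gen (i, j) - free_adj (free_gen (i, j)) | i j. True} \<union>
    {(\<Sum>k\<in>UNIV. free_gen (i, k) * free_gen (j, k)) - (if i = j then 1 else 0) | i j. True} \<union>
    {(\<Sum>k\<in>UNIV. free_gen (k, i) * free_gen (k, j)) - (if i = j then 1 else 0) | i j. True}"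

definition O_plus :: "('n::finite, (nat \<Rightarrow> ('n \<times> 'n) free_alg) set) cmqg"
  where "O_plus =
    \<lparr>alg = universal_cstar orthogonal_relations,
     gen = (\<lambda>i j. universal_gen orthogonal_relations (i, j))\<rparr>"

definition eps_relations :: "nat^'n^'n \<Rightarrow> ('n, 'a) cmqg \<Rightarrow> 'a set"
  where "eps_relations \<epsilon> G =
    (let A = alg G; u = gen G in
      {u i k \<otimes>\<^bsub>A\<^esub> u j l \<ominus>\<^bsub>A\<^esub> u j l \<otimes>\<^bsub>A\<^esub> u i k | i j k l. \<epsilon> $ i $ j = 1 \<and> \<epsilon> $ k $ l = 1} \<union>
      {u i k \<otimes>\<^bsub>A\<^esub> u j l \<ominus>\<^bsub>A\<^esub> u j k \<otimes>\<^bsub>A\<^esub> u i l | i j k l. \<epsilon> $ i $ j = 1 \<and> \<epsilon> $ k $ l = 0} \<union>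
      {u i k \<otimes>\<^bsub>A\<^esub> u j l \<ominus>\<^bsub>A\<^esub> u i l \<otimes>\<^bsub>A\<^esub> u j k | i j k l. \<epsilon> $ i $ j = 0 \<and> \<epsilon> $ k $ l = 1})"

definition eps_ideal :: "nat^'n^'n \<Rightarrow> (nat \<Rightarrow> ('n::finite \<times> 'n) free_alg) set set"
  where "eps_ideal \<epsilon> = closed_ideal_gen (alg O_plus) (eps_relations \<epsilon> O_plus)"

definition O_eps ::
    "nat^'n^'n \<Rightarrow> ('n::finite, (nat \<Rightarrow> ('n \<times> 'n) free_alg) set set) cmqg"
  where "O_eps \<epsilon> =
    \<lparr>alg = cstar_quot (alg O_plus) (eps_ideal \<epsilon>),
     gen = (\<lambda>i j. eps_ideal \<epsilon> +>\<^bsub>alg O_plus\<^esub> gen O_plus i j)\<rparr>"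

definition eps_comm :: "nat^'n^'n"
  where "eps_comm = (\<chi> i j. if i = j then 0 else 1)"

definition eps_free :: "nat^'n^'n"
  where "eps_free = 0"

end

theory Submission
  imports Defs
begin

text \<open>Since \<open>\<epsilon>\<close> is neither \<open>\<epsilon>\<^sub>c\<^sub>o\<^sub>m\<^sub>m\<close> nor \<open>\<epsilon>\<^sub>f\<^sub>r\<^sub>e\<^sub>e\<close>, there are \<open>i \<noteq> j\<close> and \<open>k \<noteq> l\<close> with \<open>\<epsilon>\<^sub>i\<^sub>j = 1\<close> and
  \<open>\<epsilon>\<^sub>k\<^sub>l = 0\<close>, so that \<open>u\<^sub>i\<^sub>k u\<^sub>j\<^sub>l = u\<^sub>j\<^sub>k u\<^sub>i\<^sub>l\<close> holds in \<open>C(O\<^sub>n\<^sup>\<epsilon>)\<close>.  The matrix of a permutation with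
  \<open>k \<mapsto> i\<close> and \<open>l \<mapsto> j\<close> violates this relation, and it is a character of \<open>C(O\<^sub>n\<^sup>+)\<close>.

  That \<open>C(O\<^sub>n\<^sup>+)\<close> is meaningful at all needs \<open>q u\<^sub>i\<^sub>j \<le> 1\<close> for every C*-seminorm \<open>q\<close> satisfying the
  orthogonality relations.  This is shown without spectral theory: a self-adjoint \<open>h\<close> with
  \<open>q h < 1\<close> is the real part of an almost unitary element, hence \<open>q (1 - 2h\<^sup>2) \<le> 1\<close>.  Applied to the
  entries of a row, whose squares add up to \<open>1\<close>, and combined by convexity of \<open>q\<close>, this gives
  the bound.\<close>

section \<open>The free *-algebra\<close>

lemma sum_single_keys: "(\<Sum>w\<in>Poly_Mapping.keys x. Poly_Mapping.single w (Poly_Mapping.lookup x w)) = x"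
  by (rule poly_mapping_eqI)
     (auto simp: lookup_sum lookup_single when_def in_keys_iff sum.delta)

lemma poly_mapping_single_induct [case_names single add]:
  assumes "\<And>w c. P (Poly_Mapping.single w c)"
    and "\<And>x y. P x \<Longrightarrow> P y \<Longrightarrow> P (x + y)"
  shows "P (x :: 'a \<Rightarrow>\<^sub>0 'b::comm_monoid_add)"
proof -
  \<comment> \<open>Zero is a monomial with coefficient zero, so the induction rule has no separate
    case for it.\<close>
  have "P 0" using assms(1)[of undefined 0] by simp
  then have "P (\<Sum>w\<in>A. Poly_Mapping.single w (Poly_Mapping.lookup x w))" for A
    by (induction A rule: infinite_finite_induct) (auto intro: assms)
  then show ?thesis by (metis sum_single_keys)
qed

lemma single_sum: "Poly_Mapping.single w (sum f A) = (\<Sum>a\<in>A. Poly_Mapping.single w (f a))"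
  by (induction A rule: infinite_finite_induct) (simp_all add: single_add)

lemma word_adj_add: "word_adj (v + w) = word_adj w + word_adj v"
  by (simp add: word_adj_def plus_star_word_def)

lemma letter_adj_letter_adj [simp]: "letter_adj (letter_adj l) = l"
  by (cases l) auto

lemma word_adj_word_adj [simp]: "word_adj (word_adj w) = w"
  by (simp add: word_adj_def rev_map o_def)

text \<open>\<open>0\<close> is the empty word, so \<open>single 0 c\<close> is a constant
  polynomial. Laws of scalar multiplication thereby become ring laws, together with the centrality
  of constants.\<close>

lemma free_scale_conv_mult: "free_scale c x = Poly_Mapping.single 0 c * x"
  by (simp add: free_scale_def mult_map_scale_conv_mult)

lemma single_zero_commute: "x * Poly_Mapping.single 0 c = Poly_Mapping.single 0 c * (x :: 'e free_alg)"
  by (induction x rule: poly_mapping_single_induct) (simp_all add: mult_single algebra_simps)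

lemma free_scale_mult_left: "free_scale c x * y = free_scale c (x * y)"
  by (simp add: free_scale_conv_mult mult.assoc)

lemma free_scale_mult_right: "x * free_scale c y = free_scale c (x * y)"
  by (metis (no_types) free_scale_conv_mult mult.assoc single_zero_commute)

lemma free_scale_add: "free_scale c (x + y) = free_scale c x + free_scale c y"
  by (simp add: free_scale_conv_mult algebra_simps)

lemma free_scale_diff: "free_scale c (x - y) = free_scale c x - free_scale c y"
  by (simp add: free_scale_conv_mult algebra_simps)

lemma free_scale_add_left: "free_scale (c + d) x = free_scale c x + free_scale d x"
  by (simp add: free_scale_conv_mult algebra_simps single_add)

lemma free_scale_diff_left: "free_scale (c - d) x = free_scale c x - free_scale d x"
  by (simp add: free_scale_conv_mult algebra_simps single_diff)

lemma free_scale_scale [simp]: "free_scale c (free_scale d x) = free_scale (c * d) x"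
  by (simp add: free_scale_conv_mult mult_single mult.assoc[symmetric])

lemma free_scale_one [simp]: "free_scale 1 x = x"
  by (simp add: free_scale_conv_mult)

lemma free_scale_minus_one: "free_scale (- 1) x = - x"
  by (simp add: free_scale_conv_mult single_uminus)

lemma free_scale_zero [simp]: "free_scale 0 x = 0"
  by (simp add: free_scale_conv_mult)

lemma free_scale_numeral: "free_scale (numeral n) x = numeral n * x"
  by (simp add: free_scale_conv_mult)

lemma free_adj_add: "free_adj (x + y) = free_adj x + free_adj y"
  unfolding free_adj_def
  by (rule setsum_keys_plus_distrib) (simp_all add: single_add)

lemma free_adj_single [simp]:
  "free_adj (Poly_Mapping.single w c) = Poly_Mapping.single (word_adj w) (cnj c)"
  by (simp add: free_adj_def)

lemma free_adj_zero [simp]: "free_adj 0 = 0"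
  by (simp add: free_adj_def)

lemma free_adj_uminus: "free_adj (- x) = - free_adj x"
  using free_adj_add[of x "- x"] by (simp add: eq_neg_iff_add_eq_0 add.commute)

lemma free_adj_diff: "free_adj (x - y) = free_adj x - free_adj y"
  using free_adj_add[of x "- y"] by (simp add: free_adj_uminus)

lemma free_adj_mult: "free_adj (x * y) = free_adj y * free_adj x"
proof (induction x rule: poly_mapping_single_induct)
  case (single v c)
  show ?case
    by (induction y rule: poly_mapping_single_induct)
       (simp_all add: mult_single word_adj_add algebra_simps free_adj_add)
qed (simp add: algebra_simps free_adj_add)

lemma free_adj_free_adj [simp]: "free_adj (free_adj x) = x"
  by (induction x rule: poly_mapping_single_induct) (simp_all add: free_adj_add)

lemma word_adj_zero [simp]: "word_adj 0 = 0"
  by (simp add: word_adj_def zero_star_word_def)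

lemma free_adj_one [simp]: "free_adj 1 = 1"
  using free_adj_single[of 0 1] by simp

lemma free_adj_scale: "free_adj (free_scale c x) = free_scale (cnj c) (free_adj x)"
  by (simp add: free_scale_conv_mult free_adj_mult single_zero_commute)


section \<open>C*-seminorms\<close>

locale free_cstar_seminorm =
  fixes q :: "'e free_alg \<Rightarrow> real"
  assumes cstar_seminorm: "cstar_seminorm q"
begin

lemma nonneg [simp]: "0 \<le> q x"
  and triangle: "q (x + y) \<le> q x + q y"
  and scale: "q (free_scale c x) = cmod c * q x"
  and submult: "q (x * y) \<le> q x * q y"
  and cstar: "q (free_adj x * x) = (q x)\<^sup>2"
  using cstar_seminorm by (auto simp: cstar_seminorm_def)

lemma zero [simp]: "q 0 = 0"
  using scale[of 0 0] by simp

lemma uminus [simp]: "q (- x) = q x"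
  using scale[of "-1" x] by (simp add: free_scale_minus_one)

lemma diff_commute: "q (x - y) = q (y - x)"
  by (metis minus_diff_eq uminus)

lemma triangle_diff: "q (x - y) \<le> q x + q y"
  using triangle[of x "- y"] by simp

lemma le_add_diff: "q x \<le> q y + q (x - y)"
  using triangle[of y "x - y"] by simp

lemma sum_le: "q (sum f A) \<le> (\<Sum>a\<in>A. q (f a))"
proof (induction A rule: infinite_finite_induct)
  case (insert a A)
  then show ?case using triangle[of "f a" "sum f A"] by simp
qed auto

text \<open>The C*-identity makes \<open>q 1\<close> an idempotent real number. It is 0 for the zero
  seminorm, so only an inequality can be claimed.\<close>

lemma one_le: "q 1 \<le> 1"
proof -
  have "(q 1)\<^sup>2 = q 1" using cstar[of 1] by simp
  then show ?thesis by (auto simp: power2_eq_square)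
qed

lemma scale_one_le: "q (free_scale c 1) \<le> cmod c"
  using mult_left_mono[OF one_le, of "cmod c"] by (simp add: scale)

text \<open>The C*-identity and submultiplicativity give
  \<open>q x * q x \<le> q (free_adj x) * q x\<close>. Cancelling \<open>q x\<close> and exchanging
  \<open>x\<close> with its adjoint gives both inequalities.\<close>

lemma adj [simp]: "q (free_adj x) = q x"
proof -
  have "q x \<le> q (free_adj x)" for x
  proof (cases "q x = 0")
    case False
    then have "0 < q x" by (simp add: less_le)
    moreover have "q x * q x \<le> q (free_adj x) * q x"
      using cstar[of x] submult[of "free_adj x" x] by (simp add: power2_eq_square)
    ultimately show ?thesis by simp
  qed simp
  from this[of x] this[of "free_adj x"] show ?thesis by simp
qed

lemma null_mult_left: "q x = 0 \<Longrightarrow> q (x * y) = 0"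
  and null_mult_right: "q y = 0 \<Longrightarrow> q (x * y) = 0"
  using submult[of x y] nonneg[of "x * y"] by auto

lemma null_add: "q x = 0 \<Longrightarrow> q y = 0 \<Longrightarrow> q (x + y) = 0"
  using triangle[of x y] nonneg[of "x + y"] by linarith

lemma null_diff_eq: "q (x - y) = 0 \<Longrightarrow> q x = q y"
  using le_add_diff[of x y] le_add_diff[of y x] diff_commute[of x y] by linarith

end

text \<open>The fixed point of the iteration is \<open>1 - sqrt (1 - h\<^sup>2)\<close>.\<close>

primrec sqrt_iter :: "'e free_alg \<Rightarrow> nat \<Rightarrow> 'e free_alg" where
  "sqrt_iter h 0 = 0"
| "sqrt_iter h (Suc n) = free_scale (1/2) (h * h + sqrt_iter h n * sqrt_iter h n)"

text \<open>Every iterate is a polynomial in \<open>h * h\<close>.\<close>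

lemma sqrt_iter_commute:
  assumes "x * h = h * x"
  shows "x * sqrt_iter h n = sqrt_iter h n * x"
proof (induction n)
  case (Suc n)
  have "x * (h * h) = h * h * x" by (metis assms mult.assoc)
  moreover have "x * (sqrt_iter h n * sqrt_iter h n) = sqrt_iter h n * sqrt_iter h n * x"
    by (metis Suc mult.assoc)
  ultimately show ?case
    by (simp add: free_scale_mult_left free_scale_mult_right distrib_left distrib_right)
qed simp

lemma sqrt_iter_adj: "free_adj h = h \<Longrightarrow> free_adj (sqrt_iter h n) = sqrt_iter h n"
  by (induction n) (simp_all add: free_adj_scale free_adj_add free_adj_mult)

lemma sqrt_iter_square: "sqrt_iter h n * sqrt_iter h n = 2 * sqrt_iter h (Suc n) - h * h"
  by (simp add: free_scale_numeral[symmetric])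

section \<open>Convergence of the iteration and the norm of a scalar minus twice a square\<close>

context free_cstar_seminorm
begin

text \<open>The ball of radius \<open>q h\<close> is invariant under the iteration: half of two
  terms of size \<open>(q h)\<^sup>2\<close> is at most \<open>q h\<close>, because
  \<open>q h \<le> 1\<close>.\<close>

lemma sqrt_iter_le:
  assumes "q h \<le> 1"
  shows "q (sqrt_iter h n) \<le> q h"
proof (induction n)
  case (Suc n)
  have "q (h * h + sqrt_iter h n * sqrt_iter h n) \<le> q h * q h + q h * q h"
    by (intro order.trans[OF triangle] add_mono order.trans[OF submult] mult_mono)
       (use Suc in auto)
  also have "\<dots> \<le> 2 * q h"
    using assms mult_right_mono[of "q h" 1 "q h"] by simp
  finally show ?case by (simp add: scale)
qed simp

text \<open>Consecutive differences shrink by the factor \<open>q h\<close>: the next difference is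
  half the product of the current difference and the sum of two iterates, and that sum has size at
  most \<open>2 * q h\<close>.\<close>

lemma sqrt_iter_diff_le:
  assumes "q h \<le> 1"
  shows "q (sqrt_iter h (Suc n) - sqrt_iter h n) \<le> q h ^ n"
proof (induction n)
  case 0
  show ?case using assms submult[of h h] mult_mono[of "q h" 1 "q h" 1] by (simp add: scale)
next
  case (Suc n)
  let ?w = "sqrt_iter h n" and ?w' = "sqrt_iter h (Suc n)"
  \<comment> \<open>The difference of squares factors only because the two iterates commute.\<close>
  have "?w * ?w' = ?w' * ?w"
    by (rule sqrt_iter_commute[OF sqrt_iter_commute[OF refl, symmetric]])
  then have "(?w' - ?w) * (?w' + ?w) = ?w' * ?w' - ?w * ?w"
    by (simp add: algebra_simps del: sqrt_iter.simps)
  also have "\<dots> = 2 * (sqrt_iter h (Suc (Suc n)) - ?w')"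
    unfolding sqrt_iter_square by (simp add: right_diff_distrib del: sqrt_iter.simps)
  finally have "q (sqrt_iter h (Suc (Suc n)) - ?w') = q ((?w' - ?w) * (?w' + ?w)) / 2"
    using scale[of 2 "sqrt_iter h (Suc (Suc n)) - ?w'"]
    by (simp add: free_scale_numeral del: sqrt_iter.simps)
  also have "\<dots> \<le> (q (?w' - ?w) * (q ?w' + q ?w)) / 2"
    by (intro divide_right_mono order.trans[OF submult] mult_left_mono triangle) auto
  also have "\<dots> \<le> (q h ^ n * (q h + q h)) / 2"
    by (intro divide_right_mono mult_mono add_mono Suc sqrt_iter_le assms) auto
  finally show ?case by (simp add: mult.commute)
qed

text \<open>For \<open>k = 1 - sqrt_iter h n\<close> the element \<open>h + \<i>k\<close> is almost unitary, and \<open>1 - 2h\<^sup>2\<close> is almost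
  the negative real part of its square.\<close>

lemma one_minus_two_square_aux:
  assumes h: "free_adj h = h" and "q h < 1"
  shows "q (1 - 2 * (h * h)) \<le> 1 + 4 * q h ^ n"
proof -
  define w where "w = sqrt_iter h n"
  define k where "k = 1 - w"
  define d where "d = sqrt_iter h (Suc n) - w"
  \<comment> \<open>The imaginary unit as an element of the algebra. The rules \<open>JJ'\<close>
    and \<open>J'\<close> below pull it to the front of products.\<close>
  define J :: "'e free_alg" where "J = Poly_Mapping.single 0 \<i>"
  have JJ: "J * J = - 1" by (simp add: J_def mult_single single_uminus)
  have J: "x * J = J * x" for x unfolding J_def by (rule single_zero_commute)
  have JJ': "J * (J * x) = - x" for x using JJ by (metis mult.assoc mult_minus1)
  have J': "x * (J * y) = J * (x * y)" for x y by (metis J mult.assoc)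
  have qd: "q d \<le> q h ^ n" using sqrt_iter_diff_le[of h n] assms by (simp add: d_def w_def)
  have hw: "h * w = w * h" unfolding w_def by (rule sqrt_iter_commute) simp
  then have hk: "h * k = k * h" by (simp add: k_def algebra_simps)
  have k: "free_adj k = k" using sqrt_iter_adj[OF h] by (simp add: k_def w_def free_adj_diff)
  have "w * w = 2 * sqrt_iter h (Suc n) - h * h"
    unfolding w_def by (rule sqrt_iter_square)
  \<comment> \<open>\<open>d\<close> measures how far \<open>w\<close> is from being a fixed point,
    and so how far \<open>u\<close> below is from being unitary.\<close>
  then have sq: "h * h + k * k = 1 + 2 * d"
    by (simp add: k_def d_def algebra_simps mult_2 del: sqrt_iter.simps)
  define u where "u = h + J * k"
  have adjJ: "free_adj J = - J" by (simp add: J_def single_uminus)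
  have u': "free_adj u = h - J * k"
    by (simp add: u_def free_adj_add free_adj_mult h k adjJ J)
  \<comment> \<open>The cross terms cancel since \<open>h\<close> and \<open>k\<close> commute,
    leaving \<open>h * h + k * k\<close>.\<close>
  have "free_adj u * u = 1 + 2 * d"
    unfolding u' unfolding u_def using sq hk by (simp add: algebra_simps mult_2 J'[of h] J'[of k] JJ')
  then have "(q u)\<^sup>2 = q (1 + 2 * d)" by (metis cstar)
  also have "\<dots> \<le> 1 + 2 * q d"
    using triangle[of 1 "2 * d"] one_le scale[of 2 d] by (simp add: free_scale_numeral)
  finally have qu: "(q u)\<^sup>2 \<le> 1 + 2 * q d" .
  \<comment> \<open>Here the cross terms of the two squares have opposite signs.\<close>
  have "u * u + free_adj u * free_adj u = 2 * (h * h) - 2 * (k * k)"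
    unfolding u' unfolding u_def by (simp add: algebra_simps mult_2 J'[of h] J'[of k] JJ')
  also have "k * k = 1 + 2 * d - h * h"
    using sq by (simp add: eq_diff_eq add.commute)
  also have "2 * (h * h) - 2 * (1 + 2 * d - h * h) = 2 * (2 * (h * h) - 1) - 4 * d"
    by (simp add: algebra_simps) (simp flip: distrib_right)
  finally have "2 * (1 - 2 * (h * h)) = - (u * u + free_adj u * free_adj u) - 4 * d" by simp
  then have "2 * q (1 - 2 * (h * h)) = q (- (u * u + free_adj u * free_adj u) - 4 * d)"
    using scale[of 2 "1 - 2 * (h * h)"] by (simp add: free_scale_numeral)
  also have "\<dots> \<le> q (u * u + free_adj u * free_adj u) + 4 * q d"
    using triangle_diff[of "- (u * u + free_adj u * free_adj u)" "4 * d"] scale[of 4 d]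
    by (simp add: free_scale_numeral del: minus_add_distrib)
  also have "\<dots> \<le> 2 * (q u)\<^sup>2 + 4 * q d"
    using triangle[of "u * u" "free_adj u * free_adj u"] submult[of u u]
      submult[of "free_adj u" "free_adj u"] by (simp add: power2_eq_square)
  finally show ?thesis using qu qd by linarith
qed

text \<open>The limit of the previous estimate. In spectral terms, \<open>h * h\<close> has spectrum
  in [0, 1], which t \<mapsto> 1 - 2t maps into [-1, 1].\<close>

lemma one_minus_two_square:
  assumes "free_adj h = h" and "q h < 1"
  shows "q (1 - 2 * (h * h)) \<le> 1"
proof (rule LIMSEQ_le_const)
  show "(\<lambda>n. 1 + 4 * q h ^ n) \<longlonglongrightarrow> 1"
    using assms by (auto intro!: tendsto_eq_intros LIMSEQ_power_zero)
qed (use one_minus_two_square_aux[OF assms] in auto)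

text \<open>Rescaling \<open>h\<close> by \<open>1 / sqrt m\<close> reduces this to the case
  \<open>m = 1\<close>.\<close>

lemma scalar_minus_two_square_strict:
  assumes h: "free_adj h = h" and m: "(q h)\<^sup>2 < m"
  shows "q (free_scale (of_real m) 1 - 2 * (h * h)) \<le> m"
proof -
  have m0: "0 < m" using m le_less_trans zero_le_power2 by blast
  define g where "g = free_scale (of_real (1 / sqrt m)) h"
  have "q h < sqrt m" using m real_less_rsqrt by blast
  then have "q g < 1" using m0 by (simp add: g_def scale norm_divide)
  then have "q (1 - 2 * (g * g)) \<le> 1"
    by (intro one_minus_two_square) (simp add: g_def free_adj_scale h)
  moreover have "free_scale (of_real m) (g * g) = h * h"
  proof -
    have "complex_of_real m * (complex_of_real (1 / sqrt m) * complex_of_real (1 / sqrt m)) = 1"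
      unfolding of_real_mult[symmetric] using m0 by simp
    then show ?thesis by (simp add: g_def free_scale_mult_left free_scale_mult_right)
  qed
  then have "free_scale (of_real m) (1 - 2 * (g * g)) = free_scale (of_real m) 1 - 2 * (h * h)"
    by (simp add: free_scale_diff free_scale_add mult_2)
  ultimately show ?thesis
    using scale[of "of_real m" "1 - 2 * (g * g)"] m0 by simp
qed

text \<open>The strict case applies to \<open>m + e / 2\<close>, and restoring the constant
  \<open>m\<close> costs at most another \<open>e / 2\<close>.\<close>

lemma scalar_minus_two_square:
  assumes h: "free_adj h = h" and m: "(q h)\<^sup>2 \<le> m"
  shows "q (free_scale (of_real m) 1 - 2 * (h * h)) \<le> m"
proof (rule field_le_epsilon)
  fix e :: real assume e: "0 < e"
  let ?y = "free_scale (of_real (m + e / 2)) 1 - 2 * (h * h)"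
  have "q ?y \<le> m + e / 2"
    using m e by (intro scalar_minus_two_square_strict h) auto
  moreover have "q (free_scale (of_real m) 1 - 2 * (h * h) - ?y) \<le> e / 2"
    using scale_one_le[of "of_real (e / 2)"] e
    by (simp add: free_scale_add_left of_real_add del: of_real_divide)
  ultimately show "q (free_scale (of_real m) 1 - 2 * (h * h)) \<le> m + e"
    using le_add_diff[of "free_scale (of_real m) 1 - 2 * (h * h)" ?y] by linarith
qed

text \<open>Let \<open>x\<close> be the square of \<open>a j\<close> and \<open>s\<close> the sum of
  the other squares, so that \<open>x + s = 1\<close> up to a null element. The bound on
  \<open>T - 2 * s\<close> becomes a bound on \<open>T - 2 + 2 * x\<close>. A positive combination
  with the bound on \<open>2 * x - v\<close> yields \<open>v * v \<le> v\<close> for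
  \<open>v = q x\<close>.\<close>

lemma sum_squares_one_le:
  assumes K: "finite K" "j \<in> K"
    and a: "\<And>k. k \<in> K \<Longrightarrow> free_adj (a k) = a k"
    and one: "q ((\<Sum>k\<in>K. a k * a k) - 1) = 0"
  shows "q (a j) \<le> 1"
proof -
  define v where "v = (q (a j))\<^sup>2"
  define x where "x = a j * a j"
  \<comment> \<open>The summand 3 makes the weight \<open>T - 2\<close> used below positive. The
    rest provides each square in \<open>s\<close> with its own constant.\<close>
  define T where "T = 3 + (\<Sum>k\<in>K-{j}. (q (a k))\<^sup>2)"
  define s where "s = (\<Sum>k\<in>K-{j}. a k * a k)"
  have T: "T \<ge> 3" by (simp add: T_def sum_nonneg)
  have xs: "q (x + s - 1) = 0"
    using one K by (simp add: x_def s_def sum.remove[of K j])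
  have "q x = v" using cstar[of "a j"] a[OF K(2)] by (simp add: x_def v_def)
  have eq: "free_scale (of_real T) 1 - 2 * s =
      free_scale 3 1 + (\<Sum>k\<in>K-{j}. free_scale (of_real ((q (a k))\<^sup>2)) 1 - 2 * (a k * a k))"
    unfolding T_def s_def of_real_add free_scale_add_left sum_subtractf sum_distrib_left[symmetric]
    by (simp add: free_scale_conv_mult single_sum)
  have "q (free_scale (of_real T) 1 - 2 * s) \<le> T"
    unfolding eq unfolding T_def
    using scale_one_le[of 3]
    by (intro order.trans[OF triangle] add_mono order.trans[OF sum_le] sum_mono
        scalar_minus_two_square a) auto
  moreover have "q (free_scale (of_real (T - 2)) 1 + 2 * x) = q (free_scale (of_real T) 1 - 2 * s)"
  proof (rule null_diff_eq)
    have "free_scale (of_real (T - 2)) 1 + 2 * x - (free_scale (of_real T) 1 - 2 * s)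
        = free_scale 2 (x + s - 1)"
      by (simp add: free_scale_diff_left free_scale_numeral algebra_simps)
    then show "q (free_scale (of_real (T - 2)) 1 + 2 * x - (free_scale (of_real T) 1 - 2 * s)) = 0"
      by (simp add: scale xs)
  qed
  ultimately have 1: "q (free_scale (of_real (T - 2)) 1 + 2 * x) \<le> T" by simp
  have 2: "q (2 * x - free_scale (of_real v) 1) \<le> v"
    using scalar_minus_two_square[OF a[OF K(2)], of v] by (simp add: x_def v_def diff_commute)
  have v: "0 \<le> v" by (simp add: v_def)
  \<comment> \<open>The weights \<open>v\<close> and \<open>T - 2\<close> make the constant terms
    cancel.\<close>
  have "free_scale (of_real (2 * (v + T - 2))) x
      = free_scale (of_real v) (free_scale (of_real (T - 2)) 1 + 2 * x)
        + free_scale (of_real (T - 2)) (2 * x - free_scale (of_real v) 1)"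
    by (simp add: free_scale_numeral[symmetric] free_scale_add free_scale_diff
        free_scale_add_left[symmetric] algebra_simps)
  moreover have "\<bar>v\<bar> = v" "\<bar>T - 2\<bar> = T - 2" "\<bar>2 * (v + T - 2)\<bar> = 2 * (v + T - 2)"
    using T v by auto
  ultimately have "2 * (v + T - 2) * v
      \<le> v * q (free_scale (of_real (T - 2)) 1 + 2 * x) + (T - 2) * q (2 * x - free_scale (of_real v) 1)"
    using triangle[of "free_scale (of_real v) (free_scale (of_real (T - 2)) 1 + 2 * x)"
        "free_scale (of_real (T - 2)) (2 * x - free_scale (of_real v) 1)"]
      scale[of "of_real (2 * (v + T - 2))" x] \<open>q x = v\<close>
    by (simp only: scale norm_of_real)
  also have "\<dots> \<le> v * T + (T - 2) * v"
    using 1 2 T v by (intro add_mono mult_left_mono) auto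
  \<comment> \<open>The terms \<open>2 * T * v\<close> on both sides cancel.\<close>
  finally have "v * v \<le> v" by (simp add: algebra_simps)
  then have "v \<le> 1" using v mult_strict_right_mono[of 1 v v] by (cases "v \<le> 1") auto
  then show ?thesis unfolding v_def by (simp add: power_le_one_iff)
qed

end


section \<open>A bound on all admissible seminorms at once\<close>

context free_cstar_seminorm
begin

lemma single_le:
  assumes "\<And>e. q (free_gen e) \<le> 1"
  shows "q (Poly_Mapping.single w c) \<le> cmod c"
proof -
  have letter: "q (Poly_Mapping.single (Word [l]) 1) \<le> 1" for l
  proof (cases l)
    case (Gen e)
    then show ?thesis using assms[of e] by (simp add: free_gen_def)
  next
    case (Adj e)
    then have "Poly_Mapping.single (Word [l]) 1 = free_adj (free_gen e)"
      by (simp add: free_gen_def word_adj_def)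
    then show ?thesis using assms[of e] by simp
  qed
  have word: "q (Poly_Mapping.single (Word ls) 1) \<le> 1" for ls
  proof (induction ls)
    case Nil
    show ?case using one_le by (simp add: zero_star_word_def[symmetric])
  next
    case (Cons l ls)
    have "Poly_Mapping.single (Word (l # ls)) 1
        = Poly_Mapping.single (Word [l]) 1 * (Poly_Mapping.single (Word ls) 1 :: 'e free_alg)"
      by (simp add: mult_single plus_star_word_def)
    then show ?case
      using submult mult_mono[OF letter Cons] by (metis mult_1 nonneg order.trans zero_le_one)
  qed
  have "Poly_Mapping.single w c = free_scale c (Poly_Mapping.single w 1)"
    by (simp add: free_scale_conv_mult mult_single)
  then show ?thesis
    using mult_left_mono[OF word[of "letters w"], of "cmod c"] by (simp add: scale)
qed

text \<open>The right-hand side is independent of \<open>q\<close>, which makes the supremum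
  defining the universal seminorm finite.\<close>

lemma le_sum_lookup:
  assumes "\<And>e. q (free_gen e) \<le> 1"
  shows "q x \<le> (\<Sum>w\<in>Poly_Mapping.keys x. cmod (Poly_Mapping.lookup x w))"
proof -
  have "q (\<Sum>w\<in>Poly_Mapping.keys x. Poly_Mapping.single w (Poly_Mapping.lookup x w))
      \<le> (\<Sum>w\<in>Poly_Mapping.keys x. cmod (Poly_Mapping.lookup x w))"
    by (rule order.trans[OF sum_le sum_mono]) (rule single_le[OF assms])
  then show ?thesis by (simp only: sum_single_keys)
qed

end

text \<open>The generators are self-adjoint only up to null elements. They are replaced by their
  real parts \<open>a k\<close>, which are exactly self-adjoint and still have squares summing to 1
  up to a null element.\<close>

lemma orthogonal_relations_gen_le:
  fixes q :: "('n::finite \<times> 'n) free_alg \<Rightarrow> real"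
  assumes q: "cstar_seminorm q" and R: "\<And>r. r \<in> orthogonal_relations \<Longrightarrow> q r = 0"
  shows "q (free_gen e) \<le> 1"
proof -
  interpret free_cstar_seminorm q by unfold_locales fact
  obtain i j where e: "e = (i, j)" by (cases e)
  define u where "u k = free_gen (i, k)" for k :: 'n
  define a where "a k = free_scale (1/2) (u k + free_adj (u k))" for k
  have "q (u k - free_adj (u k)) = 0" for k
    by (rule R) (auto simp: orthogonal_relations_def u_def)
  moreover have "a k - u k = - free_scale (1/2) (u k - free_adj (u k))" for k
  proof -
    \<comment> \<open>\<open>s\<close> and \<open>t\<close> stand for the halves of
      \<open>u k\<close> and of its adjoint, and \<open>v\<close> for \<open>u k\<close>.\<close>
    have "s + t - v = - (s - t)" if "s + s = v" for s t v :: "('n \<times> 'n) free_alg"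
      using that by (auto simp: algebra_simps)
    from this[OF free_scale_add_left[of "1/2" "1/2" "u k", symmetric]] show ?thesis
      by (simp add: a_def free_scale_add free_scale_diff)
  qed
  ultimately have au: "q (a k - u k) = 0" for k by (simp add: scale)
  have "q (a k * a k - u k * u k) = 0" for k
  proof -
    have "a k * a k - u k * u k = (a k - u k) * a k + u k * (a k - u k)"
      by (simp add: algebra_simps)
    then show ?thesis by (simp add: null_add null_mult_left null_mult_right au)
  qed
  then have "q (\<Sum>k\<in>UNIV. a k * a k - u k * u k) = 0"
    using sum_le[of "\<lambda>k. a k * a k - u k * u k" UNIV] by (simp add: antisym)
  moreover have "q ((\<Sum>k\<in>UNIV. u k * u k) - 1) = 0"
    by (rule R) (auto simp: orthogonal_relations_def u_def)
  ultimately have "q ((\<Sum>k\<in>UNIV. a k * a k - u k * u k) + ((\<Sum>k\<in>UNIV. u k * u k) - 1)) = 0"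
    by (rule null_add)
  then have "q ((\<Sum>k\<in>UNIV. a k * a k) - 1) = 0"
    by (simp add: sum_subtractf)
  then have "q (a j) \<le> 1"
    by (intro sum_squares_one_le[of UNIV])
      (auto simp: a_def free_adj_scale free_adj_add add.commute)
  then show ?thesis
    using null_diff_eq[OF au] by (simp add: u_def e)
qed

section \<open>The universal seminorm is a C*-seminorm\<close>

lemma universal_seminorm_upper:
  assumes "bdd_above ((\<lambda>q. q x) ` {q. cstar_seminorm q \<and> (\<forall>r\<in>R. q r = 0)})"
    and "cstar_seminorm q" "\<forall>r\<in>R. q r = 0"
  shows "q x \<le> universal_seminorm R x"
  unfolding universal_seminorm_def using assms by (intro cSUP_upper) auto

text \<open>It vanishes on every set of relations, so the family under the supremum is
  nonempty.\<close>

lemma cstar_seminorm_zero: "cstar_seminorm (\<lambda>x. 0)"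
  by (simp add: cstar_seminorm_def)

lemma cstar_seminorm_universal:
  assumes bdd: "\<And>x. bdd_above ((\<lambda>q. q x) ` {q. cstar_seminorm q \<and> (\<forall>r\<in>R. q r = 0)})"
  shows "cstar_seminorm (universal_seminorm R)"
proof -
  let ?Q = "{q. cstar_seminorm q \<and> (\<forall>r\<in>R. q r = 0)}"
  let ?p = "universal_seminorm R"
  have ne: "?Q \<noteq> {}" using cstar_seminorm_zero by auto
  have up: "q x \<le> ?p x" if "q \<in> ?Q" for q x
    using that by (intro universal_seminorm_upper bdd) auto
  have least: "?p x \<le> b" if "\<And>q. q \<in> ?Q \<Longrightarrow> q x \<le> b" for x b
    unfolding universal_seminorm_def by (rule cSUP_least[OF ne that])
  have loc: "free_cstar_seminorm q" if "q \<in> ?Q" for q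
    using that by unfold_locales auto
  have p0: "0 \<le> ?p x" for x
    using up[of "\<lambda>_. 0"] cstar_seminorm_zero by auto
  show ?thesis unfolding cstar_seminorm_def
  proof (intro conjI allI)
    show "0 \<le> ?p x" for x by (rule p0)
    show "?p (x + y) \<le> ?p x + ?p y" for x y
    proof (rule least)
      fix q assume q: "q \<in> ?Q"
      interpret free_cstar_seminorm q by (rule loc[OF q])
      show "q (x + y) \<le> ?p x + ?p y"
        by (rule order.trans[OF triangle add_mono]) (rule up[OF q])+
    qed
    show "?p (x * y) \<le> ?p x * ?p y" for x y
    proof (rule least)
      fix q assume q: "q \<in> ?Q"
      interpret free_cstar_seminorm q by (rule loc[OF q])
      show "q (x * y) \<le> ?p x * ?p y"
        by (rule order.trans[OF submult mult_mono]) (rule up[OF q] p0 nonneg)+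
    qed
    show "?p (free_scale c x) = cmod c * ?p x" for c x
    proof -
      \<comment> \<open>For \<open>c \<noteq> 0\<close> the reverse inequality is this one for the
        scalar \<open>1 / c\<close> and the element \<open>free_scale c x\<close>.\<close>
      have le: "?p (free_scale c x) \<le> cmod c * ?p x" for c x
        by (rule least) (simp add: free_cstar_seminorm.scale[OF loc] up mult_left_mono)
      show ?thesis
      proof (cases "c = 0")
        case True
        then show ?thesis using le[of c x] p0[of "free_scale c x"] by simp
      next
        case False
        then have "?p x \<le> cmod (1 / c) * ?p (free_scale c x)"
          using le[of "1 / c" "free_scale c x"] by simp
        with False have "cmod c * ?p x \<le> ?p (free_scale c x)"
          by (simp add: norm_divide field_simps)
        with le[of c x] show ?thesis by simp
      qed
    qed
    show "?p (free_adj x * x) = (?p x)\<^sup>2" for x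
    proof (rule antisym)
      \<comment> \<open>The C*-identity holds for each \<open>q\<close> separately. Taking square
        roots lets it pass to the supremum.\<close>
      have sq: "q x \<le> sqrt (?p (free_adj x * x))" if "q \<in> ?Q" for q
        using up[OF that, of "free_adj x * x"]
        by (simp add: free_cstar_seminorm.cstar[OF loc[OF that]] real_le_rsqrt)
      show "?p (free_adj x * x) \<le> (?p x)\<^sup>2"
        by (rule least)
          (simp add: free_cstar_seminorm.cstar[OF loc] free_cstar_seminorm.nonneg[OF loc] up power_mono)
      have "?p x \<le> sqrt (?p (free_adj x * x))"
        by (rule least[OF sq])
      from power_mono[OF this p0, of 2] show "(?p x)\<^sup>2 \<le> ?p (free_adj x * x)"
        by (simp add: p0)
    qed
  qed
qed

lemma bdd_above_orthogonal_relations: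
  fixes x :: "('n::finite \<times> 'n) free_alg"
  shows
  "bdd_above ((\<lambda>q. q x) ` {q. cstar_seminorm q \<and> (\<forall>r\<in>orthogonal_relations. q r = 0)})"
proof (rule bdd_aboveI2)
  fix q :: "('n::finite \<times> 'n) free_alg \<Rightarrow> real"
  assume q: "q \<in> {q. cstar_seminorm q \<and> (\<forall>r\<in>orthogonal_relations. q r = 0)}"
  then interpret free_cstar_seminorm q by unfold_locales auto
  show "q x \<le> (\<Sum>w\<in>Poly_Mapping.keys x. cmod (Poly_Mapping.lookup x w))"
    using q by (intro le_sum_lookup orthogonal_relations_gen_le) auto
qed

lemmas cstar_seminorm_universal_orthogonal =
  cstar_seminorm_universal[OF bdd_above_orthogonal_relations]


section \<open>Characters\<close>

primrec letter_eval :: "('e \<Rightarrow> complex) \<Rightarrow> 'e letter \<Rightarrow> complex" where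
  "letter_eval a (Gen e) = a e"
| "letter_eval a (Adj e) = cnj (a e)"

definition word_eval :: "('e \<Rightarrow> complex) \<Rightarrow> 'e star_word \<Rightarrow> complex"
  where "word_eval a w = prod_list (map (letter_eval a) (letters w))"

definition free_eval :: "('e \<Rightarrow> complex) \<Rightarrow> 'e free_alg \<Rightarrow> complex"
  where "free_eval a x = (\<Sum>w\<in>Poly_Mapping.keys x. Poly_Mapping.lookup x w * word_eval a w)"

lemma word_eval_zero [simp]: "word_eval a 0 = 1"
  by (simp add: word_eval_def zero_star_word_def)

lemma word_eval_add: "word_eval a (v + w) = word_eval a v * word_eval a w"
  by (simp add: word_eval_def plus_star_word_def)

lemma letter_eval_adj: "letter_eval a (letter_adj l) = cnj (letter_eval a l)"
  by (cases l) auto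

lemma word_eval_adj: "word_eval a (word_adj w) = cnj (word_eval a w)"
proof -
  have "prod_list (map (letter_eval a) (rev (map letter_adj ls)))
      = cnj (prod_list (map (letter_eval a) ls))" for ls
    by (induction ls) (simp_all add: letter_eval_adj mult.commute)
  then show ?thesis by (simp add: word_eval_def word_adj_def)
qed

lemma free_eval_single [simp]: "free_eval a (Poly_Mapping.single w c) = c * word_eval a w"
  by (simp add: free_eval_def)

lemma free_eval_gen [simp]: "free_eval a (free_gen e) = a e"
  by (simp add: free_gen_def word_eval_def)

lemma free_eval_one [simp]: "free_eval a 1 = 1"
  using free_eval_single[of a 0 1] by simp

lemma free_eval_zero [simp]: "free_eval a 0 = 0"
  by (simp add: free_eval_def)

lemma free_eval_add: "free_eval a (x + y) = free_eval a x + free_eval a y"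
  unfolding free_eval_def by (rule setsum_keys_plus_distrib) (simp_all add: algebra_simps)

lemma free_eval_mult: "free_eval a (x * y) = free_eval a x * free_eval a y"
proof (induction x rule: poly_mapping_single_induct)
  case (single v c)
  show ?case
    by (induction y rule: poly_mapping_single_induct)
       (simp_all add: mult_single word_eval_add algebra_simps free_eval_add)
qed (simp add: algebra_simps free_eval_add)

lemma free_eval_adj: "free_eval a (free_adj x) = cnj (free_eval a x)"
  by (induction x rule: poly_mapping_single_induct)
     (simp_all add: free_adj_add free_eval_add word_eval_adj)

lemma free_eval_diff: "free_eval a (x - y) = free_eval a x - free_eval a y"
  using free_eval_add[of a "x - y" y] by simp

lemma free_eval_sum: "free_eval a (sum f A) = (\<Sum>k\<in>A. free_eval a (f k))"
  by (induction A rule: infinite_finite_induct) (simp_all add: free_eval_add)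

lemma cstar_seminorm_free_eval: "cstar_seminorm (\<lambda>x. cmod (free_eval a x))"
  by (auto simp: cstar_seminorm_def free_eval_add free_eval_mult free_eval_adj norm_triangle_ineq
      norm_mult free_scale_conv_mult power2_eq_square)

text \<open>The entries of an orthogonal matrix satisfy the relations, so evaluation at it is an
  admissible seminorm. A polynomial that does not vanish there is therefore nonzero in
  \<open>alg O_plus\<close>.\<close>

lemma free_eval_le_universal_orthogonal:
  fixes m :: "real^'n^'n"
  assumes "orthogonal_matrix m"
  shows "cmod (free_eval (\<lambda>(i, j). complex_of_real (m $ i $ j)) x)
    \<le> universal_seminorm orthogonal_relations x"
proof (rule universal_seminorm_upper[OF bdd_above_orthogonal_relations cstar_seminorm_free_eval], rule ballI)
  have "m ** transpose m = mat 1" "transpose m ** m = mat 1"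
    using assms by (simp_all add: orthogonal_matrix_def)
  then have 1: "(\<Sum>k\<in>UNIV. m $ i $ k * m $ j $ k) = (if i = j then 1 else 0)"
    "(\<Sum>k\<in>UNIV. m $ k $ i * m $ k $ j) = (if i = j then 1 else 0)" for i j
    by (simp_all add: vec_eq_iff matrix_matrix_mult_def transpose_def mat_def)
  note 2 = 1[THEN arg_cong[of _ _ complex_of_real], unfolded of_real_sum of_real_mult]
  fix r :: "('n \<times> 'n) free_alg" assume "r \<in> orthogonal_relations"
  then show "cmod (free_eval (\<lambda>(i, j). complex_of_real (m $ i $ j)) r) = 0"
    by (auto simp: orthogonal_relations_def free_eval_diff free_eval_sum free_eval_mult free_eval_adj 2)
qed


section \<open>Quotients of *-algebras\<close>

text \<open>The algebraic structure that is passed through two successive quotients. Scalars act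
  through multiples of the unit, so two-sided ideals are closed under them.\<close>

locale star_ring = ring A for A :: "'a cstar" (structure) +
  assumes smult_one_closed: "c \<odot> \<one> \<in> carrier A"
    and smult_conv_mult: "x \<in> carrier A \<Longrightarrow> c \<odot> x = (c \<odot> \<one>) \<otimes> x"
    and adj_closed: "x \<in> carrier A \<Longrightarrow> adj A x \<in> carrier A"
    and adj_add: "x \<in> carrier A \<Longrightarrow> y \<in> carrier A \<Longrightarrow> adj A (x \<oplus> y) = adj A x \<oplus> adj A y"
begin

lemma smult_closed: "x \<in> carrier A \<Longrightarrow> c \<odot> x \<in> carrier A"
  by (metis smult_conv_mult smult_one_closed m_closed)

lemma smult_add: "x \<in> carrier A \<Longrightarrow> y \<in> carrier A \<Longrightarrow> c \<odot> (x \<oplus> y) = c \<odot> x \<oplus> c \<odot> y"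
  by (metis smult_conv_mult smult_one_closed add.m_closed r_distr)

end

locale star_ideal = star_ring A + ideal I A for I and A (structure) +
  assumes adj_mem: "x \<in> I \<Longrightarrow> adj A x \<in> I"
begin

lemma smult_mem: "x \<in> I \<Longrightarrow> c \<odot> x \<in> I"
  by (metis smult_conv_mult smult_one_closed a_Hcarr I_l_closed)

text \<open>The scalar action and the adjoint of \<open>cstar_quot\<close> are unions over all
  representatives. For an additive \<open>f\<close> preserving \<open>I\<close> every representative
  yields the same coset, so the union collapses.\<close>

lemma coset_map:
  assumes "\<And>x y. x \<in> carrier A \<Longrightarrow> y \<in> carrier A \<Longrightarrow> f (x \<oplus> y) = f x \<oplus> f y"
    and "\<And>x. x \<in> carrier A \<Longrightarrow> f x \<in> carrier A"
    and "\<And>x. x \<in> I \<Longrightarrow> f x \<in> I" and x: "x \<in> carrier A"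
  shows "(\<Union>y\<in>I +> x. I +> f y) = I +> f x"
proof -
  have "I +> f y = I +> f x" if "y \<in> I +> x" for y
  proof -
    from that obtain i where "i \<in> I" "y = i \<oplus> x"
      by (auto simp: a_r_coset_def r_coset_def)
    then have "f y \<in> I +> f x"
      using assms by (auto simp: a_r_coset_def r_coset_def)
    then show ?thesis using a_repr_independence' assms x by simp
  qed
  moreover have "x \<in> I +> x" by (rule a_rcos_self[OF x])
  ultimately show ?thesis by blast
qed

lemma cstar_quot_simps:
  "carrier (cstar_quot A I) = carrier (A Quot I)"
  "mult (cstar_quot A I) = mult (A Quot I)"
  "one (cstar_quot A I) = I +> \<one>"
  "zero (cstar_quot A I) = zero (A Quot I)"
  "add (cstar_quot A I) = add (A Quot I)"
  by (simp_all add: cstar_quot_def FactRing_def)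

lemma cstar_quot_mult:
  "x \<in> carrier A \<Longrightarrow> y \<in> carrier A \<Longrightarrow>
    (I +> x) \<otimes>\<^bsub>cstar_quot A I\<^esub> (I +> y) = I +> (x \<otimes> y)"
  by (simp add: cstar_quot_simps FactRing_def rcoset_mult_add)

lemma cstar_quot_smult: "x \<in> carrier A \<Longrightarrow> c \<odot>\<^bsub>cstar_quot A I\<^esub> (I +> x) = I +> (c \<odot> x)"
  by (simp add: cstar_quot_def) (rule coset_map[OF smult_add smult_closed smult_mem])

lemma cstar_quot_adj: "x \<in> carrier A \<Longrightarrow> adj (cstar_quot A I) (I +> x) = I +> adj A x"
  by (simp add: cstar_quot_def) (rule coset_map[OF adj_add adj_closed adj_mem])

lemma cstar_quot_carrier: "carrier (cstar_quot A I) = (\<lambda>x. I +> x) ` carrier A"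
  by (auto simp: cstar_quot_simps FactRing_def A_RCOSETS_defs a_r_coset_def)

lemma ring_cstar_quot: "ring (cstar_quot A I)"
proof -
  interpret Q: ring "A Quot I" by (rule quotient_is_ring)
  show ?thesis
  proof (rule ringI)
    show "abelian_group (cstar_quot A I)"
      by (rule abelian_groupI)
        (use Q.l_neg in \<open>auto simp: cstar_quot_def Q.a_ac intro: bexI[OF _ Q.a_inv_closed]\<close>)
    show "Group.monoid (cstar_quot A I)"
      by (rule monoidI) (auto simp: cstar_quot_def Q.m_assoc)
  qed (auto simp: cstar_quot_def Q.l_distr Q.r_distr)
qed

lemma coset_ring_hom: "(\<lambda>x. I +> x) \<in> ring_hom A (cstar_quot A I)"
  using rcos_ring_hom by (simp add: ring_hom_def cstar_quot_simps FactRing_def)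

lemma coset_star_hom: "(\<lambda>x. I +> x) \<in> star_hom A (cstar_quot A I)"
  by (simp add: star_hom_def coset_ring_hom cstar_quot_smult cstar_quot_adj)

text \<open>This allows quotients to be iterated: \<open>O_eps\<close> is a quotient of
  \<open>O_plus\<close>, which is itself a quotient of an algebra of Cauchy sequences.\<close>

lemma star_ring_cstar_quot: "star_ring (cstar_quot A I)"
proof -
  have one: "\<one>\<^bsub>cstar_quot A I\<^esub> = I +> \<one>" by (simp add: cstar_quot_simps)
  show ?thesis
  proof (intro star_ring.intro ring_cstar_quot star_ring_axioms.intro)
    show "c \<odot>\<^bsub>cstar_quot A I\<^esub> \<one>\<^bsub>cstar_quot A I\<^esub> \<in> carrier (cstar_quot A I)" for c
      by (simp only: one cstar_quot_smult[OF one_closed] ring_hom_closed[OF coset_ring_hom smult_one_closed])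
    show "c \<odot>\<^bsub>cstar_quot A I\<^esub> X
        = (c \<odot>\<^bsub>cstar_quot A I\<^esub> \<one>\<^bsub>cstar_quot A I\<^esub>) \<otimes>\<^bsub>cstar_quot A I\<^esub> X"
      if "X \<in> carrier (cstar_quot A I)" for c X
    proof -
      from that obtain x where x: "x \<in> carrier A" "X = I +> x"
        by (auto simp: cstar_quot_carrier)
      then show ?thesis
        by (simp only: one cstar_quot_smult one_closed cstar_quot_mult smult_one_closed
            smult_conv_mult[OF x(1), symmetric])
    qed
    show "adj (cstar_quot A I) X \<in> carrier (cstar_quot A I)"
      if "X \<in> carrier (cstar_quot A I)" for X
      using that by (auto simp: cstar_quot_carrier cstar_quot_adj adj_closed)
    show "adj (cstar_quot A I) (X \<oplus>\<^bsub>cstar_quot A I\<^esub> Y)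
        = adj (cstar_quot A I) X \<oplus>\<^bsub>cstar_quot A I\<^esub> adj (cstar_quot A I) Y"
      if "X \<in> carrier (cstar_quot A I)" "Y \<in> carrier (cstar_quot A I)" for X Y
    proof -
      from that obtain x y where x: "x \<in> carrier A" "X = I +> x" and y: "y \<in> carrier A" "Y = I +> y"
        by (auto simp: cstar_quot_carrier)
      show ?thesis unfolding x(2) y(2)
        by (simp add: ring_hom_add[OF coset_ring_hom, symmetric] cstar_quot_adj adj_add adj_closed x(1) y(1))
    qed
  qed
qed

end

section \<open>Closed ideals generated by relations\<close>

context star_ring
begin

text \<open>This makes the intersection that defines the generated ideal one over a nonempty
  family.\<close>

lemma closed_star_ideal_carrier: "closed_star_ideal (carrier A) A"
  by (simp add: closed_star_ideal_def oneideal adj_closed)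

lemma closed_ideal_gen_superset: "S \<subseteq> closed_ideal_gen A S"
  by (auto simp: closed_ideal_gen_def)

lemma star_ideal_closed_ideal_gen:
  assumes "S \<subseteq> carrier A"
  shows "star_ideal (closed_ideal_gen A S) A"
proof -
  have "ideal (closed_ideal_gen A S) A"
    unfolding closed_ideal_gen_def
    using closed_star_ideal_carrier assms
    by (intro i_Intersect) (auto simp: closed_star_ideal_def)
  then show ?thesis
    by (intro star_ideal.intro star_ring_axioms star_ideal_axioms.intro)
      (auto simp: closed_ideal_gen_def closed_star_ideal_def)
qed

end


section \<open>Separated completions\<close>

lemma cauchy_alg_simps [simp]:
  "carrier (cauchy_alg p) = cauchy_seqs p"
  "X \<otimes>\<^bsub>cauchy_alg p\<^esub> Y = (\<lambda>n. X n * Y n)"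
  "X \<oplus>\<^bsub>cauchy_alg p\<^esub> Y = (\<lambda>n. X n + Y n)"
  "\<one>\<^bsub>cauchy_alg p\<^esub> = (\<lambda>n. 1)"
  "\<zero>\<^bsub>cauchy_alg p\<^esub> = (\<lambda>n. 0)"
  "c \<odot>\<^bsub>cauchy_alg p\<^esub> X = (\<lambda>n. free_scale c (X n))"
  "adj (cauchy_alg p) X = (\<lambda>n. free_adj (X n))"
  by (simp_all add: cauchy_alg_def)

context free_cstar_seminorm
begin

lemma const_cauchy: "(\<lambda>n. x) \<in> cauchy_seqs q"
  by (simp add: cauchy_seqs_def)

lemma cauchy_seqsI:
  assumes "\<And>e. 0 < e \<Longrightarrow> \<exists>N. \<forall>m\<ge>N. \<forall>n\<ge>N. q (X m - X n) < e"
  shows "X \<in> cauchy_seqs q"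
  using assms by (simp add: cauchy_seqs_def)

lemma cauchy_seqsD:
  assumes "X \<in> cauchy_seqs q" "0 < e"
  obtains N where "\<And>m n. m \<ge> N \<Longrightarrow> n \<ge> N \<Longrightarrow> q (X m - X n) < e"
  using assms unfolding cauchy_seqs_def by blast

lemma cauchy_bounded:
  assumes "X \<in> cauchy_seqs q"
  obtains B where "0 < B" "\<And>n. q (X n) \<le> B"
proof -
  obtain N where N: "\<And>m n. m \<ge> N \<Longrightarrow> n \<ge> N \<Longrightarrow> q (X m - X n) < 1"
    using cauchy_seqsD[OF assms, of 1] by auto
  \<comment> \<open>The sum controls the terms up to \<open>N\<close>; every later term lies within
    1 of \<open>X N\<close>.\<close>
  define B where "B = 1 + (\<Sum>n\<le>N. q (X n))"
  have le: "q (X n) \<le> B - 1" if "n \<le> N" for n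
    unfolding B_def using member_le_sum[of n "{..N}" "\<lambda>n. q (X n)"] that by simp
  have "q (X n) \<le> B" for n
  proof (cases "n \<le> N")
    case False
    then have "q (X n) \<le> q (X N) + 1"
      using le_add_diff[of "X n" "X N"] N[of n N] by simp
    then show ?thesis using le[of N] by simp
  qed (use le[of n] in simp)
  moreover have "0 < B" unfolding B_def by (simp add: add_pos_nonneg sum_nonneg)
  ultimately show ?thesis by (rule that[rotated])
qed

lemma cauchy_add:
  assumes X: "X \<in> cauchy_seqs q" and Y: "Y \<in> cauchy_seqs q"
  shows "(\<lambda>n. X n + Y n) \<in> cauchy_seqs q"
proof (rule cauchy_seqsI)
  fix e :: real assume "0 < e"
  then obtain N M where N: "\<And>m n. m \<ge> N \<Longrightarrow> n \<ge> N \<Longrightarrow> q (X m - X n) < e / 2"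
    and M: "\<And>m n. m \<ge> M \<Longrightarrow> n \<ge> M \<Longrightarrow> q (Y m - Y n) < e / 2"
    using cauchy_seqsD[OF X, of "e / 2"] cauchy_seqsD[OF Y, of "e / 2"] by (metis half_gt_zero)
  have "q (X m + Y m - (X n + Y n)) < e" if "m \<ge> max N M" "n \<ge> max N M" for m n
    using triangle[of "X m - X n" "Y m - Y n"] N[of m n] M[of m n] that by (simp add: algebra_simps)
  then show "\<exists>N. \<forall>m\<ge>N. \<forall>n\<ge>N. q (X m + Y m - (X n + Y n)) < e" by blast
qed

lemma cauchy_mult:
  assumes X: "X \<in> cauchy_seqs q" and Y: "Y \<in> cauchy_seqs q"
  shows "(\<lambda>n. X n * Y n) \<in> cauchy_seqs q"
proof (rule cauchy_seqsI)
  fix e :: real assume e: "0 < e"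
  obtain B C where B: "0 < B" "\<And>n. q (X n) \<le> B" and C: "0 < C" "\<And>n. q (Y n) \<le> C"
    using cauchy_bounded[OF X] cauchy_bounded[OF Y] by metis
  obtain N M where N: "\<And>m n. m \<ge> N \<Longrightarrow> n \<ge> N \<Longrightarrow> q (X m - X n) < e / (2 * C)"
    and M: "\<And>m n. m \<ge> M \<Longrightarrow> n \<ge> M \<Longrightarrow> q (Y m - Y n) < e / (2 * B)"
    using cauchy_seqsD[OF X, of "e / (2 * C)"] cauchy_seqsD[OF Y, of "e / (2 * B)"] B(1) C(1) e
    by (metis divide_pos_pos mult_pos_pos zero_less_numeral)
  have "q (X m * Y m - X n * Y n) < e" if "m \<ge> max N M" "n \<ge> max N M" for m n
  proof -
    have "X m * Y m - X n * Y n = (X m - X n) * Y m + X n * (Y m - Y n)"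
      by (simp add: algebra_simps)
    then have "q (X m * Y m - X n * Y n) \<le> q (X m - X n) * q (Y m) + q (X n) * q (Y m - Y n)"
      using order.trans[OF triangle add_mono[OF submult submult]] by simp
    also have "\<dots> \<le> q (X m - X n) * C + B * q (Y m - Y n)"
      using B C by (intro add_mono mult_left_mono mult_right_mono) auto
    also have "\<dots> < e / (2 * C) * C + B * (e / (2 * B))"
      using B(1) C(1) N[of m n] M[of m n] that
      by (intro add_strict_mono mult_strict_left_mono mult_strict_right_mono) auto
    finally show ?thesis using B(1) C(1) by simp
  qed
  then show "\<exists>N. \<forall>m\<ge>N. \<forall>n\<ge>N. q (X m * Y m - X n * Y n) < e" by blast
qed

lemma cauchy_uminus: "X \<in> cauchy_seqs q \<Longrightarrow> (\<lambda>n. - X n) \<in> cauchy_seqs q"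
  using cauchy_mult[OF const_cauchy[of "- 1"]] by simp

lemma cauchy_adj: "X \<in> cauchy_seqs q \<Longrightarrow> (\<lambda>n. free_adj (X n)) \<in> cauchy_seqs q"
  by (simp add: cauchy_seqs_def free_adj_diff[symmetric])

lemma ring_cauchy_alg: "ring (cauchy_alg q)"
proof (rule ringI)
  show "abelian_group (cauchy_alg q)"
  proof (rule abelian_groupI)
    show "\<exists>Y\<in>carrier (cauchy_alg q). Y \<oplus>\<^bsub>cauchy_alg q\<^esub> X = \<zero>\<^bsub>cauchy_alg q\<^esub>"
      if "X \<in> carrier (cauchy_alg q)" for X
      using that by (intro bexI[of _ "\<lambda>n. - X n"]) (auto intro: cauchy_uminus)
  qed (auto simp: cauchy_add const_cauchy algebra_simps)
  show "Group.monoid (cauchy_alg q)"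
    by (rule monoidI) (auto simp: cauchy_mult const_cauchy algebra_simps)
qed (auto simp: algebra_simps)

lemma star_ring_cauchy_alg: "star_ring (cauchy_alg q)"
  by (intro star_ring.intro ring_cauchy_alg star_ring_axioms.intro)
    (auto simp: const_cauchy cauchy_adj free_adj_add free_scale_mult_left)

lemma null_seqsD: "X \<in> null_seqs q \<Longrightarrow> (\<lambda>n. q (X n)) \<longlonglongrightarrow> 0"
  by (simp add: null_seqs_def)

lemma null_seqs_cauchy:
  assumes "X \<in> null_seqs q"
  shows "X \<in> cauchy_seqs q"
proof (rule cauchy_seqsI)
  fix e :: real assume "0 < e"
  then obtain N where N: "\<And>n. n \<ge> N \<Longrightarrow> q (X n) < e / 2"
    using LIMSEQ_D[OF null_seqsD[OF assms], of "e / 2"] by auto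
  have "q (X m - X n) < e" if "m \<ge> N" "n \<ge> N" for m n
    using triangle_diff[of "X m" "X n"] N[OF that(1)] N[OF that(2)] by simp
  then show "\<exists>N. \<forall>m\<ge>N. \<forall>n\<ge>N. q (X m - X n) < e" by blast
qed

lemma null_seqsI:
  assumes "Y \<longlonglongrightarrow> 0" "\<And>n. q (X n) \<le> Y n"
  shows "X \<in> null_seqs q"
  unfolding null_seqs_def mem_Collect_eq
  by (rule tendsto_sandwich[OF _ _ tendsto_const assms(1)]) (auto simp: assms(2))

lemma null_seqs_mult:
  assumes X: "X \<in> null_seqs q" and Y: "Y \<in> cauchy_seqs q"
  shows "(\<lambda>n. X n * Y n) \<in> null_seqs q" "(\<lambda>n. Y n * X n) \<in> null_seqs q"
proof -
  obtain B where B: "0 < B" "\<And>n. q (Y n) \<le> B" using cauchy_bounded[OF Y] by metis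
  have lim: "(\<lambda>n. B * q (X n)) \<longlonglongrightarrow> 0"
    using tendsto_mult_right_zero[OF null_seqsD[OF X]] .
  show "(\<lambda>n. Y n * X n) \<in> null_seqs q"
    by (rule null_seqsI[OF lim]) (rule order.trans[OF submult mult_right_mono[OF B(2) nonneg]])
  \<comment> \<open>Commutativity is applied to the real bound \<open>B * q (X n)\<close>, not in
    the algebra.\<close>
  show "(\<lambda>n. X n * Y n) \<in> null_seqs q"
    by (rule null_seqsI[OF lim])
      (subst mult.commute, rule order.trans[OF submult mult_left_mono[OF B(2) nonneg]])
qed

lemma star_ideal_null_seqs: "star_ideal (null_seqs q) (cauchy_alg q)"
proof -
  interpret star_ring "cauchy_alg q" by (rule star_ring_cauchy_alg)
  \<comment> \<open>The abstract additive inverse has to be identified with pointwise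
    negation.\<close>
  have minus: "inv\<^bsub>add_monoid (cauchy_alg q)\<^esub> X = (\<lambda>n. - X n)" if "X \<in> cauchy_seqs q" for X
    using minus_equality[of "\<lambda>n. - X n" X] that
    by (simp add: a_inv_def cauchy_uminus)
  have "ideal (null_seqs q) (cauchy_alg q)"
  proof (rule idealI[OF ring_axioms])
    show "subgroup (null_seqs q) (add_monoid (cauchy_alg q))"
    proof
      show "null_seqs q \<subseteq> carrier (add_monoid (cauchy_alg q))"
        by (auto intro: null_seqs_cauchy)
      show "X \<otimes>\<^bsub>add_monoid (cauchy_alg q)\<^esub> Y \<in> null_seqs q"
        if "X \<in> null_seqs q" "Y \<in> null_seqs q" for X Y
        using null_seqsI[OF tendsto_add_zero[OF that[THEN null_seqsD]] triangle] by simp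
      show "\<one>\<^bsub>add_monoid (cauchy_alg q)\<^esub> \<in> null_seqs q" by (simp add: null_seqs_def)
      show "inv\<^bsub>add_monoid (cauchy_alg q)\<^esub> X \<in> null_seqs q" if "X \<in> null_seqs q" for X
        unfolding minus[OF null_seqs_cauchy[OF that]] using that by (simp add: null_seqs_def)
    qed
  qed (auto intro: null_seqs_mult)
  then show ?thesis
    by (intro star_ideal.intro star_ring_axioms star_ideal_axioms.intro) (auto simp: null_seqs_def)
qed

text \<open>Two constant sequences in the same coset differ by a constant null sequence, whose
  seminorm is zero.\<close>

lemma const_coset_eqD:
  assumes "null_seqs q +>\<^bsub>cauchy_alg q\<^esub> (\<lambda>n. x) = null_seqs q +>\<^bsub>cauchy_alg q\<^esub> (\<lambda>n. y)"
  shows "q (x - y) = 0"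
proof -
  interpret star_ideal "null_seqs q" "cauchy_alg q" by (rule star_ideal_null_seqs)
  have "(\<lambda>n. x) \<in> null_seqs q +>\<^bsub>cauchy_alg q\<^esub> (\<lambda>n. y)"
    unfolding assms[symmetric] by (rule a_rcos_self) (simp add: const_cauchy)
  then obtain z where "z \<in> null_seqs q" "(\<lambda>n. x) = (\<lambda>n. z n + y)"
    by (auto simp: a_r_coset_def r_coset_def)
  then have "(\<lambda>n. x - y) \<in> null_seqs q"
    by (metis (no_types, lifting) add_diff_cancel_right' ext)
  then show ?thesis by (simp add: null_seqs_def LIMSEQ_const_iff)
qed

end


section \<open>The quantum groups\<close>

abbreviation orth_seminorm :: "('n::finite \<times> 'n) free_alg \<Rightarrow> real"
  where "orth_seminorm \<equiv> universal_seminorm orthogonal_relations"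

lemma free_cstar_seminorm_orth: "free_cstar_seminorm orth_seminorm"
  by (rule free_cstar_seminorm.intro) (rule cstar_seminorm_universal_orthogonal)

lemma alg_O_plus:
  "alg O_plus = cstar_quot (cauchy_alg orth_seminorm) (null_seqs orth_seminorm)"
  by (simp add: O_plus_def universal_cstar_def)

lemma gen_O_plus:
  "gen O_plus i j = null_seqs orth_seminorm +>\<^bsub>cauchy_alg orth_seminorm\<^esub> (\<lambda>n. free_gen (i, j))"
  by (simp add: O_plus_def universal_gen_def)

lemma star_ring_O_plus: "star_ring (alg O_plus)"
  unfolding alg_O_plus
  by (intro star_ideal.star_ring_cstar_quot free_cstar_seminorm.star_ideal_null_seqs
      free_cstar_seminorm_orth)

lemma gen_O_plus_closed: "gen O_plus i j \<in> carrier (alg O_plus)"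
  unfolding alg_O_plus gen_O_plus
    star_ideal.cstar_quot_carrier[OF free_cstar_seminorm.star_ideal_null_seqs[OF free_cstar_seminorm_orth]]
  by (rule imageI) (simp add: free_cstar_seminorm.const_cauchy free_cstar_seminorm_orth)

lemma gen_O_plus_mult:
  "gen O_plus i k \<otimes>\<^bsub>alg O_plus\<^esub> gen O_plus j l
    = null_seqs orth_seminorm +>\<^bsub>cauchy_alg orth_seminorm\<^esub> (\<lambda>n. free_gen (i, k) * free_gen (j, l))"
proof -
  interpret free_cstar_seminorm orth_seminorm by (rule free_cstar_seminorm_orth)
  show ?thesis
    unfolding alg_O_plus gen_O_plus
    by (simp add: star_ideal.cstar_quot_mult[OF star_ideal_null_seqs] const_cauchy)
qed

lemma eps_relations_closed: "eps_relations \<epsilon> O_plus \<subseteq> carrier (alg O_plus)"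
proof -
  interpret star_ring "alg O_plus" by (rule star_ring_O_plus)
  show ?thesis
    unfolding eps_relations_def Let_def by (auto simp: gen_O_plus_closed)
qed

lemma star_ideal_eps_ideal: "star_ideal (eps_ideal \<epsilon>) (alg O_plus)"
  unfolding eps_ideal_def
  by (rule star_ring.star_ideal_closed_ideal_gen[OF star_ring_O_plus eps_relations_closed])

lemma alg_O_eps: "alg (O_eps \<epsilon>) = cstar_quot (alg O_plus) (eps_ideal \<epsilon>)"
  and gen_O_eps: "gen (O_eps \<epsilon>) i j = eps_ideal \<epsilon> +>\<^bsub>alg O_plus\<^esub> gen O_plus i j"
  by (simp_all add: O_eps_def)

text \<open>The difference of the two products belongs to the relations that generate the
  ideal.\<close>

lemma eps_coset_eq:
  assumes "\<epsilon> $ i $ j = 1" "\<epsilon> $ k $ l = 0"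
  shows "eps_ideal \<epsilon> +>\<^bsub>alg O_plus\<^esub> (gen O_plus i k \<otimes>\<^bsub>alg O_plus\<^esub> gen O_plus j l)
    = eps_ideal \<epsilon> +>\<^bsub>alg O_plus\<^esub> (gen O_plus j k \<otimes>\<^bsub>alg O_plus\<^esub> gen O_plus i l)"
proof -
  interpret star_ideal "eps_ideal \<epsilon>" "alg O_plus" by (rule star_ideal_eps_ideal)
  have "gen O_plus i k \<otimes>\<^bsub>alg O_plus\<^esub> gen O_plus j l
      \<ominus>\<^bsub>alg O_plus\<^esub> gen O_plus j k \<otimes>\<^bsub>alg O_plus\<^esub> gen O_plus i l \<in> eps_relations \<epsilon> O_plus"
    unfolding eps_relations_def Let_def using assms by blast
  then have "gen O_plus i k \<otimes>\<^bsub>alg O_plus\<^esub> gen O_plus j l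
      \<ominus>\<^bsub>alg O_plus\<^esub> gen O_plus j k \<otimes>\<^bsub>alg O_plus\<^esub> gen O_plus i l \<in> eps_ideal \<epsilon>"
    unfolding eps_ideal_def using closed_ideal_gen_superset by blast
  then show ?thesis
    by (subst (asm) quotient_eq_iff_same_a_r_cos[OF ideal_axioms])
      (simp_all add: gen_O_plus_closed)
qed

lemma gen_O_eps_relation:
  assumes "\<epsilon> $ i $ j = 1" "\<epsilon> $ k $ l = 0"
  shows "gen (O_eps \<epsilon>) i k \<otimes>\<^bsub>alg (O_eps \<epsilon>)\<^esub> gen (O_eps \<epsilon>) j l
    = gen (O_eps \<epsilon>) j k \<otimes>\<^bsub>alg (O_eps \<epsilon>)\<^esub> gen (O_eps \<epsilon>) i l"
  unfolding alg_O_eps gen_O_eps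
  by (simp add: star_ideal.cstar_quot_mult[OF star_ideal_eps_ideal] gen_O_plus_closed
      eps_coset_eq[OF assms])

lemma gen_O_eps_closed: "gen (O_eps \<epsilon>) i j \<in> carrier (alg (O_eps \<epsilon>))"
  unfolding alg_O_eps gen_O_eps star_ideal.cstar_quot_carrier[OF star_ideal_eps_ideal]
  by (rule imageI) (rule gen_O_plus_closed)

lemma quantum_inclusion_O_eps:
  "quantum_inclusion (O_eps \<epsilon>) O_plus (\<lambda>x. eps_ideal \<epsilon> +>\<^bsub>alg O_plus\<^esub> x)"
  unfolding quantum_inclusion_def alg_O_eps gen_O_eps
  using star_ideal.coset_star_hom[OF star_ideal_eps_ideal]
    star_ideal.cstar_quot_carrier[OF star_ideal_eps_ideal] by blast

section \<open>Permutation matrices as witnesses\<close>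

lemma permutation_matrix_component: "permutation_matrix \<sigma> $ p $ q = (if p = \<sigma> q then 1 else 0)"
  by (simp add: permutation_matrix_def)

lemma orthogonal_permutation_matrix:
  fixes \<sigma> :: "'n::finite \<Rightarrow> 'n"
  assumes "bij \<sigma>"
  shows "orthogonal_matrix (permutation_matrix \<sigma>)"
  unfolding orthogonal_matrix
  using assms
  by (auto simp: vec_eq_iff matrix_matrix_mult_def transpose_def mat_def permutation_matrix_component
      if_distrib[of "\<lambda>x. x * _"] cong: if_cong dest: bij_is_inj[THEN injD])

lemma bij_two_points:
  fixes i j k l :: 'a
  assumes "i \<noteq> j" "k \<noteq> l"
  obtains \<sigma> where "bij \<sigma>" "\<sigma> k = i" "\<sigma> l = j"
proof
  let ?\<tau> = "Transposition.transpose k i"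
  \<comment> \<open>The first transposition sends \<open>k\<close> to \<open>i\<close>. The second
    moves the image of \<open>l\<close> to \<open>j\<close> and fixes \<open>i\<close>, which
    differs both from that image and from \<open>j\<close>.\<close>
  let ?\<sigma> = "Transposition.transpose (?\<tau> l) j \<circ> ?\<tau>"
  show "bij ?\<sigma>" by (simp add: bij_comp)
  have "?\<tau> l \<noteq> i" using assms(2) by (metis transpose_apply_first transpose_involutory)
  then show "?\<sigma> k = i" using assms(1) by simp
  show "?\<sigma> l = j" by simp
qed

text \<open>A permutation \<open>\<sigma>\<close> with \<open>\<sigma> k = i\<close> and \<open>\<sigma> l = j\<close> violates \<open>u\<^sub>i\<^sub>k u\<^sub>j\<^sub>l = u\<^sub>j\<^sub>k u\<^sub>i\<^sub>l\<close>.\<close>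

lemma not_classical_subgroup_O_eps:
  fixes \<epsilon> :: "nat^'n::finite^'n"
  assumes eps: "\<epsilon> $ i $ j = 1" "\<epsilon> $ k $ l = 0" and ne: "i \<noteq> j" "k \<noteq> l"
    and X: "\<And>\<sigma>. bij \<sigma> \<Longrightarrow> permutation_matrix \<sigma> \<in> X"
  shows "\<not> classical_cmqg X \<subseteq>\<^sub>Q O_eps \<epsilon>"
proof
  assume "classical_cmqg X \<subseteq>\<^sub>Q O_eps \<epsilon>"
  then obtain \<phi> where hom: "\<phi> \<in> ring_hom (alg (O_eps \<epsilon>)) (cfun_alg X)"
    and gen: "\<And>i j. \<phi> (gen (O_eps \<epsilon>) i j) = (\<lambda>a\<in>X. complex_of_real (a $ i $ j))"
    by (auto simp: quantum_subgroup_def quantum_inclusion_def star_hom_def classical_cmqg_def)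
  have mult: "\<phi> (gen (O_eps \<epsilon>) i k \<otimes>\<^bsub>alg (O_eps \<epsilon>)\<^esub> gen (O_eps \<epsilon>) j l) a
      = complex_of_real (a $ i $ k) * complex_of_real (a $ j $ l)" if "a \<in> X" for a i j k l
    using that by (simp add: ring_hom_mult[OF hom] gen_O_eps_closed gen cfun_alg_def)
  obtain \<sigma> where \<sigma>: "bij \<sigma>" "\<sigma> k = i" "\<sigma> l = j" using bij_two_points[OF ne] .
  \<comment> \<open>The left side equals 1, while the right side is 0 because
    \<open>\<sigma> k = i \<noteq> j\<close>.\<close>
  have "complex_of_real (permutation_matrix \<sigma> $ i $ k) * complex_of_real (permutation_matrix \<sigma> $ j $ l)
      = complex_of_real (permutation_matrix \<sigma> $ j $ k) * complex_of_real (permutation_matrix \<sigma> $ i $ l)"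
    using mult[OF X[OF \<sigma>(1)]] gen_O_eps_relation[OF eps] by metis
  then show False using \<sigma> ne by (simp add: permutation_matrix_component)
qed

text \<open>Evaluation at a permutation matrix with \<open>k \<mapsto> i\<close> and
  \<open>l \<mapsto> j\<close> gives 1 on the difference, which bounds its universal seminorm away
  from zero.\<close>

lemma gen_O_plus_mult_neq:
  fixes i j k l :: "'n::finite"
  assumes ne: "i \<noteq> j" "k \<noteq> l"
  shows "gen O_plus i k \<otimes>\<^bsub>alg O_plus\<^esub> gen O_plus j l \<noteq> gen O_plus j k \<otimes>\<^bsub>alg O_plus\<^esub> gen O_plus i l"
proof
  assume "gen O_plus i k \<otimes>\<^bsub>alg O_plus\<^esub> gen O_plus j l = gen O_plus j k \<otimes>\<^bsub>alg O_plus\<^esub> gen O_plus i l"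
  then have 0: "orth_seminorm (free_gen (i, k) * free_gen (j, l) - free_gen (j, k) * free_gen (i, l)) = 0"
    unfolding gen_O_plus_mult
    by (rule free_cstar_seminorm.const_coset_eqD[OF free_cstar_seminorm_orth])
  obtain \<sigma> where \<sigma>: "bij \<sigma>" "\<sigma> k = i" "\<sigma> l = j" using bij_two_points[OF ne] .
  show False
    using free_eval_le_universal_orthogonal[OF orthogonal_permutation_matrix[OF \<sigma>(1)],
        of "free_gen (i, k) * free_gen (j, l) - free_gen (j, k) * free_gen (i, l)"] \<sigma> ne
    by (simp add: 0 free_eval_diff free_eval_mult permutation_matrix_component)
qed

text \<open>The quotient map identifies the two products of generators, which are distinct in
  \<open>alg O_plus\<close>.\<close>

lemma O_eps_proper_O_plus:
  assumes "\<epsilon> $ i $ j = 1" "\<epsilon> $ k $ l = 0" "i \<noteq> j" "k \<noteq> l"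
  shows "O_eps \<epsilon> \<subset>\<^sub>Q O_plus"
proof -
  interpret star_ring "alg O_plus" by (rule star_ring_O_plus)
  have "\<not> inj_on (\<lambda>x. eps_ideal \<epsilon> +>\<^bsub>alg O_plus\<^esub> x) (carrier (alg O_plus))"
    using eps_coset_eq[OF assms(1,2)] gen_O_plus_mult_neq[OF assms(3,4)]
    by (meson gen_O_plus_closed inj_onD m_closed)
  then show ?thesis
    unfolding proper_quantum_subgroup_def using quantum_inclusion_O_eps by blast
qed

theorem proposition5p3:
  fixes \<epsilon> :: "nat^'n^'n::finite"
  assumes "\<forall>i j. \<epsilon> $ i $ j \<in> {0, 1}"
    and "transpose \<epsilon> = \<epsilon>"
    and "\<forall>i. \<epsilon> $ i $ i = 0"
    and "\<epsilon> \<noteq> eps_comm"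
    and "\<epsilon> \<noteq> eps_free"
  shows "(\<not> (O_classical :: ('n, real^'n^'n \<Rightarrow> complex) cmqg) \<subseteq>\<^sub>Q O_eps \<epsilon> \<and> O_eps \<epsilon> \<subset>\<^sub>Q O_plus) \<and>
    (\<not> (S_classical :: ('n, real^'n^'n \<Rightarrow> complex) cmqg) \<subseteq>\<^sub>Q O_eps \<epsilon> \<and> O_eps \<epsilon> \<subset>\<^sub>Q O_plus)"
proof -
  obtain i j where "\<epsilon> $ i $ j \<noteq> 0"
    using assms(5) by (auto simp: vec_eq_iff eps_free_def)
  with assms(1) have ij: "\<epsilon> $ i $ j = 1"
    by (metis empty_iff insert_iff)
  with assms(3) have "i \<noteq> j" by auto
  \<comment> \<open>Both diagonals vanish, so a place where \<open>\<epsilon>\<close> differs from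
    \<open>eps_comm\<close> is off the diagonal and carries the entry 0.\<close>
  obtain k l where "\<epsilon> $ k $ l \<noteq> (if k = l then 0 else 1)"
    using assms(4) by (auto simp: vec_eq_iff eps_comm_def)
  with assms(1,3) have kl: "\<epsilon> $ k $ l = 0" and "k \<noteq> l"
    by (auto split: if_splits)
  \<comment> \<open>Both groups are covered, since each of the two sets of matrices contains all
    permutation matrices.\<close>
  note not_sub = not_classical_subgroup_O_eps[OF ij kl \<open>i \<noteq> j\<close> \<open>k \<noteq> l\<close>]
  have "\<not> O_classical \<subseteq>\<^sub>Q O_eps \<epsilon>"
    unfolding O_classical_def by (rule not_sub) (simp add: orthogonal_permutation_matrix)
  moreover have "\<not> S_classical \<subseteq>\<^sub>Q O_eps \<epsilon>"
    unfolding S_classical_def by (rule not_sub) auto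
  ultimately show ?thesis
    using O_eps_proper_O_plus[OF ij kl \<open>i \<noteq> j\<close> \<open>k \<noteq> l\<close>] by simp
qed

end
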